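(* Let $\mathcal{H}=\mathbb{Q}\langle Y\rangle$, $Y=\{z_k:k\in\mathbb{Z}\}$, be the quasi-shuffle Hopf algebra (quasi-shuffle product $\ast$, deconcatenation coproduct, counit $\varepsilon$), let $N$ be the linear span of non-singular words, let $\mathcal{N}$ be the two-sided ideal generated by $N$ (a Hopf ideal), and let $\mathcal{A}$ be a nonzero commutative unital $\mathbb{Q}$-algebra. Let $\mathfrak{t}_{\mathcal{A}}$ be the Lie algebra of the renormalisation group $T_{\mathcal{A}}$, i.e. the space of $\mathcal{A}$-valued infinitesimal characters of $\mathcal{H}/\mathcal{N}$: linear maps $\delta:\mathcal{H}/\mathcal{N}\to\mathcal{A}$ with $\delta(xy)=\delta(x)\varepsilon(y)+\varepsilon(x)\delta(y)$. Then $\mathfrak{t}_{\mathcal{A}}$ is infinite-dimensional.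
   Context: The quasi-shuffle product: $\mathbf{1}\ast v=v\ast\mathbf{1}=v$, $z_mv\ast z_nw=z_m(v\ast z_nw)+z_n(z_mv\ast w)+z_{m+n}(v\ast w)$. Coproduct: $\Delta(w)=\sum_{uv=w}u\otimes v$; $\varepsilon(\mathbf{1})=1$, $\varepsilon(w)=0$ otherwise. A word $z_{k_1}\cdots z_{k_n}$ is non-singular if $k_1\neq1$, $k_1+k_2\notin\{2,1,0,-2,-4,\ldots\}$ and $k_1+\cdots+k_j\notin\mathbb{Z}_{\le j}$ for $3\le j\le n$. $T_{\mathcal{A}}$ is the group (under convolution) of unital algebra morphisms $(\mathcal{H},\ast)\to\mathcal{A}$ vanishing on $N$, equivalently the $\mathcal{A}$-valued characters of $\mathcal{H}/\mathcal{N}$. *)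

theory Defs
  imports Complex_Main "HOL-Algebra.QuotRing" "HOL-Library.Poly_Mapping" "HOL-Library.Function_Algebras"
begin

section \<open>The quasi-shuffle algebra\<close>

text \<open>A word \<open>z\<^sub>k\<^sub>1 \<dots> z\<^sub>k\<^sub>n\<close> is the list \<open>[k1, \<dots>, kn]\<close> of its indices, and the rational
  vector space with basis the words is \<open>int list \<Rightarrow>\<^sub>0 rat\<close>. The library's multiplication on
  \<open>\<Rightarrow>\<^sub>0\<close> is not used.\<close>

type_synonym words = "int list \<Rightarrow>\<^sub>0 rat"

definition word :: "int list \<Rightarrow> words" where
  "word w = Poly_Mapping.single w 1"

definition qscale :: "rat \<Rightarrow> words \<Rightarrow> words" where
  "qscale c p = Poly_Mapping.map (\<lambda>r. c * r) p"

text \<open>Linear extension of a map given on words.\<close>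

definition lin_ext :: "(int list \<Rightarrow> words) \<Rightarrow> words \<Rightarrow> words" where
  "lin_ext f p = (\<Sum>w\<in>Poly_Mapping.keys p. qscale (Poly_Mapping.lookup p w) (f w))"

definition prepend :: "int \<Rightarrow> words \<Rightarrow> words" where
  "prepend k = lin_ext (\<lambda>w. word (k # w))"

fun qs_word :: "int list \<Rightarrow> int list \<Rightarrow> words" where
  "qs_word [] v = word v"
| "qs_word v [] = word v"
| "qs_word (m # v) (n # w) =
     prepend m (qs_word v (n # w)) + prepend n (qs_word (m # v) w)
       + prepend (m + n) (qs_word v w)"

definition qs_mult :: "words \<Rightarrow> words \<Rightarrow> words" where
  "qs_mult p q = lin_ext (\<lambda>u. lin_ext (\<lambda>v. qs_word u v) q) p"

definition qs_ring :: "words ring" where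
  "qs_ring = \<lparr>carrier = UNIV, mult = qs_mult, one = word [], zero = 0, add = (+)\<rparr>"

definition counit :: "words \<Rightarrow> rat" where
  "counit p = Poly_Mapping.lookup p []"


section \<open>Non-singular words and the quotient\<close>

text \<open>The empty word is excluded: were it non-singular, the ideal below would be everything, and
  no unital morphism could vanish on it. The forbidden set \<open>{2, 1, 0, -2, -4, \<dots>}\<close> consists of 1
  and the even integers up to 2.\<close>

definition non_singular :: "int list \<Rightarrow> bool" where
  "non_singular ks \<longleftrightarrow> ks \<noteq> [] \<and> ks ! 0 \<noteq> 1
     \<and> (2 \<le> length ks \<longrightarrow> ks ! 0 + ks ! 1 \<notin> {1} \<union> {s. even s \<and> s \<le> 2})
     \<and> (\<forall>j. 3 \<le> j \<and> j \<le> length ks \<longrightarrow> sum_list (take j ks) \<notin> {..int j})"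

definition N_span :: "words set" where
  "N_span = module.span qscale (word ` Collect non_singular)"

definition N_ideal :: "words set" where
  "N_ideal = Idl\<^bsub>qs_ring\<^esub> N_span"

definition H_quot :: "words set ring" where
  "H_quot = qs_ring Quot N_ideal"

text \<open>Scalar multiplication and counit on cosets are given by all representatives at once; the
  counit is well defined because it vanishes on the ideal.\<close>

definition quot_scale :: "rat \<Rightarrow> words set \<Rightarrow> words set" where
  "quot_scale c X = (\<Union>x\<in>X. N_ideal +>\<^bsub>qs_ring\<^esub> qscale c x)"

definition quot_counit :: "words set \<Rightarrow> rat" where
  "quot_counit X = the_elem (counit ` X)"


section \<open>Infinitesimal characters\<close>

locale comm_rat_algebra = vector_space scale
  for scale :: "rat \<Rightarrow> 'a::comm_ring_1 \<Rightarrow> 'a" +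
  assumes scale_mult: "scale c (x * y) = scale c x * y"

text \<open>A map on the quotient is represented by a function on all sets of \<open>words\<close> which is 0 outside
  the cosets. These functions are closed under pointwise operations, and distinct ones differ on
  some coset, so dimensions are those of the space of maps on the quotient.
  The deconcatenation coproduct only enters the Lie bracket, not the underlying space.\<close>

definition inf_chars :: "(rat \<Rightarrow> 'a \<Rightarrow> 'a) \<Rightarrow> (words set \<Rightarrow> 'a::comm_ring_1) set" where
  "inf_chars scale = {\<delta>.
     (\<forall>X. X \<notin> carrier H_quot \<longrightarrow> \<delta> X = 0)
   \<and> (\<forall>X\<in>carrier H_quot. \<forall>Y\<in>carrier H_quot. \<delta> (X \<oplus>\<^bsub>H_quot\<^esub> Y) = \<delta> X + \<delta> Y)
   \<and> (\<forall>c. \<forall>X\<in>carrier H_quot. \<delta> (quot_scale c X) = scale c (\<delta> X))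
   \<and> (\<forall>X\<in>carrier H_quot. \<forall>Y\<in>carrier H_quot.
        \<delta> (X \<otimes>\<^bsub>H_quot\<^esub> Y) = scale (quot_counit Y) (\<delta> X) + scale (quot_counit X) (\<delta> Y))}"

definition infinite_dim :: "('s::comm_ring_1 \<Rightarrow> 'b \<Rightarrow> 'b) \<Rightarrow> 'b::ab_group_add set \<Rightarrow> bool" where
  "infinite_dim s V \<longleftrightarrow> \<not> (\<exists>B. finite B \<and> B \<subseteq> V \<and> V \<subseteq> module.span s B)"

end

theory Submission
  imports Defs "HOL-Computational_Algebra.Polynomial" "Jordan_Normal_Form.Determinant"
begin

text \<open>Both the quasi-shuffle product and deconcatenation preserve the weight \<open>k\<^sub>1 + \<dots> + k\<^sub>n\<close>, and the
  only non-singular word of weight 0 is \<open>z\<^sub>0\<close>. So it suffices to find infinitely many independent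
  infinitesimal characters of the full quasi-shuffle algebra that are concentrated in weight 0 and
  vanish on \<open>z\<^sub>0\<close>. Differentiating the character \<open>w \<mapsto> t choose |w|\<close> at \<open>t = 0\<close> and keeping only
  weight \<open>a\<close> gives an infinitesimal character \<open>\<lambda>\<^sub>a\<close>. The convolution brackets \<open>[\<lambda>\<^sub>k, \<lambda>\<^sub>-\<^sub>k]\<close> for
  \<open>k \<ge> 1\<close> have weight 0, vanish on one-letter words, and take on \<open>z\<^sub>j z\<^sub>-\<^sub>j\<close> with \<open>j \<ge> 1\<close> the value 1 if
  \<open>j = k\<close> and 0 otherwise. A finitely generated module of functions over a nonzero commutative ring
  has no such infinite family: the product of two square matrices, one with a zero row, is not 1.\<close>

section \<open>Linear functionals on the space of words\<close>

definition ev :: "(int list \<Rightarrow> rat) \<Rightarrow> words \<Rightarrow> rat" where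
  "ev f p = (\<Sum>w\<in>Poly_Mapping.keys p. Poly_Mapping.lookup p w * f w)"

lemma ev_superset:
  assumes "finite S" "Poly_Mapping.keys p \<subseteq> S"
  shows "ev f p = (\<Sum>w\<in>S. Poly_Mapping.lookup p w * f w)"
  unfolding ev_def using assms by (intro sum.mono_neutral_left) (auto simp: in_keys_iff)

lemma ev_plus [simp]: "ev f (p + q) = ev f p + ev f q"
proof -
  let ?S = "Poly_Mapping.keys p \<union> Poly_Mapping.keys q"
  have "ev f (p + q) = (\<Sum>w\<in>?S. Poly_Mapping.lookup (p + q) w * f w)"
    by (intro ev_superset Poly_Mapping.keys_add) auto
  moreover have "ev f p = (\<Sum>w\<in>?S. Poly_Mapping.lookup p w * f w)" by (intro ev_superset) auto
  moreover have "ev f q = (\<Sum>w\<in>?S. Poly_Mapping.lookup q w * f w)" by (intro ev_superset) auto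
  ultimately show ?thesis by (simp add: lookup_add distrib_right sum.distrib)
qed

lemma lookup_qscale [simp]: "Poly_Mapping.lookup (qscale c p) w = c * Poly_Mapping.lookup p w"
  by (simp add: qscale_def Poly_Mapping.map.rep_eq when_def)

lemma ev_qscale [simp]: "ev f (qscale c p) = c * ev f p"
proof -
  have "ev f (qscale c p) = (\<Sum>w\<in>Poly_Mapping.keys p. Poly_Mapping.lookup (qscale c p) w * f w)"
    by (intro ev_superset) (auto simp: in_keys_iff)
  then show ?thesis by (simp add: ev_def sum_distrib_left mult.assoc)
qed

lemma ev_0 [simp]: "ev f 0 = 0"
  by (simp add: ev_def)

lemma ev_sum [simp]: "ev f (\<Sum>i\<in>I. p i) = (\<Sum>i\<in>I. ev f (p i))"
  by (induction I rule: infinite_finite_induct) auto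

lemma ev_word [simp]: "ev f (word w) = f w"
  by (simp add: ev_def word_def)

lemma ev_lin_ext [simp]: "ev g (lin_ext f p) = ev (\<lambda>w. ev g (f w)) p"
  by (simp add: lin_ext_def ev_def[of "\<lambda>w. ev g (f w)"])

lemma ev_add_fun: "ev (\<lambda>w. f w + g w) p = ev f p + ev g p"
  by (simp add: ev_def distrib_left sum.distrib)

lemma ev_diff_fun: "ev (\<lambda>w. f w - g w) p = ev f p - ev g p"
  by (simp add: ev_def right_diff_distrib sum_subtractf)

lemma ev_mult_left: "ev (\<lambda>w. c * f w) p = c * ev f p"
  by (simp add: ev_def sum_distrib_left mult_ac)

lemma ev_mult_right: "ev (\<lambda>w. f w * c) p = ev f p * c"
  using ev_mult_left[of c f p] by (simp add: mult.commute)

lemma ev_zero_fun [simp]: "ev (\<lambda>w. 0) p = 0"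
  by (simp add: ev_def)

lemma lookup_eq_ev: "Poly_Mapping.lookup p x = ev (\<lambda>w. if w = x then 1 else 0) p"
  by (simp add: ev_def if_distrib sum.delta in_keys_iff cong: if_cong)

text \<open>Coordinates are themselves functionals. Identities between elements are tested against
  every \<open>ev f\<close>, under which each \<open>lin_ext\<close> becomes a nested
  evaluation.\<close>

lemma words_eqI: "(\<And>f. ev f p = ev f q) \<Longrightarrow> p = q"
  by (rule poly_mapping_eqI) (simp add: lookup_eq_ev)

lemma ev_commute: "ev (\<lambda>u. ev (\<lambda>v. f u v) q) p = ev (\<lambda>v. ev (\<lambda>u. f u v) p) q"
  unfolding ev_def sum_distrib_left by (subst sum.swap) (simp add: mult_ac)

lemma ev_prepend [simp]: "ev f (prepend k p) = ev (\<lambda>w. f (k # w)) p"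
  by (simp add: prepend_def)

section \<open>The quasi-shuffle ring\<close>

lemma ev_qs_mult: "ev f (qs_mult p q) = ev (\<lambda>u. ev (\<lambda>v. ev f (qs_word u v)) q) p"
  by (simp add: qs_mult_def)

lemma qs_word_Nil_right [simp]: "qs_word u [] = word u"
  by (cases u) auto

lemma qs_mult_word [simp]: "qs_mult (word u) (word v) = qs_word u v"
  by (rule words_eqI) (simp add: ev_qs_mult)

lemma qs_mult_plus_left: "qs_mult (p + p') q = qs_mult p q + qs_mult p' q"
  and qs_mult_plus_right: "qs_mult p (q + q') = qs_mult p q + qs_mult p q'"
  and qs_mult_qscale_left: "qs_mult (qscale c p) q = qscale c (qs_mult p q)"
  and qs_mult_one_left: "qs_mult (word []) p = p"
  and qs_mult_one_right: "qs_mult p (word []) = p"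
  by (rule words_eqI, simp add: ev_qs_mult ev_add_fun)+

lemma prepend_plus: "prepend k (p + q) = prepend k p + prepend k q"
  and prepend_word: "prepend k (word w) = word (k # w)"
  by (rule words_eqI, simp)+

text \<open>The recursion of \<open>qs_word\<close>, extended bilinearly: the inner products met in
  the proof of associativity are no longer single words.\<close>

lemma qs_mult_prepend:
  "qs_mult (prepend m p) (prepend n q) =
     prepend m (qs_mult p (prepend n q)) + prepend n (qs_mult (prepend m p) q)
       + prepend (m + n) (qs_mult p q)"
  by (rule words_eqI) (simp add: ev_qs_mult ev_add_fun)

text \<open>Both bracketings expand into the same seven terms, one for each nonempty subset of the
  three leading letters, whose sum becomes the first letter. The remaining factors are shorter in
  total, so strong induction on the total length applies.\<close>

lemma qs_mult_assoc_word:
  "qs_mult (qs_mult (word u) (word v)) (word w) = qs_mult (word u) (qs_mult (word v) (word w))"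
proof (induction "length u + length v + length w" arbitrary: u v w rule: less_induct)
  case less
  show ?case
  proof (cases "u = [] \<or> v = [] \<or> w = []")
    case True
    then show ?thesis by (auto simp del: qs_mult_word simp: qs_mult_one_left qs_mult_one_right)
  next
    case False
    then obtain a u' b v' c w' where [simp]: "u = a # u'" "v = b # v'" "w = c # w'"
      by (meson neq_Nil_conv)
    define U V W where "U = word u'" "V = word v'" "W = word w'"
    let ?x = "prepend a U" and ?y = "prepend b V" and ?z = "prepend c W"
    note IH = less[of u' v w] less[of u v' w] less[of u v w'] less[of u' v' w] less[of u' v w']
      less[of u v' w'] less[of u' v' w']
    have IH: "qs_mult (qs_mult U ?y) ?z = qs_mult U (qs_mult ?y ?z)"
      "qs_mult (qs_mult ?x V) ?z = qs_mult ?x (qs_mult V ?z)"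
      "qs_mult (qs_mult ?x ?y) W = qs_mult ?x (qs_mult ?y W)"
      "qs_mult (qs_mult U V) ?z = qs_mult U (qs_mult V ?z)"
      "qs_mult (qs_mult U ?y) W = qs_mult U (qs_mult ?y W)"
      "qs_mult (qs_mult ?x V) W = qs_mult ?x (qs_mult V W)"
      "qs_mult (qs_mult U V) W = qs_mult U (qs_mult V W)"
      using IH by (simp_all add: U_V_W_def prepend_word del: qs_mult_word)
    have L: "qs_mult (qs_mult ?x ?y) ?z =
       prepend a (qs_mult (qs_mult U ?y) ?z) + prepend b (qs_mult (qs_mult ?x V) ?z)
       + prepend c (qs_mult (qs_mult ?x ?y) W) + prepend (a + b) (qs_mult (qs_mult U V) ?z)
       + prepend (a + c) (qs_mult (qs_mult U ?y) W) + prepend (b + c) (qs_mult (qs_mult ?x V) W)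
       + prepend (a + b + c) (qs_mult (qs_mult U V) W)"
      by (simp add: qs_mult_prepend qs_mult_plus_left prepend_plus ac_simps)
    have R: "qs_mult ?x (qs_mult ?y ?z) =
       prepend a (qs_mult U (qs_mult ?y ?z)) + prepend b (qs_mult ?x (qs_mult V ?z))
       + prepend c (qs_mult ?x (qs_mult ?y W)) + prepend (a + b) (qs_mult U (qs_mult V ?z))
       + prepend (a + c) (qs_mult U (qs_mult ?y W)) + prepend (b + c) (qs_mult ?x (qs_mult V W))
       + prepend (a + b + c) (qs_mult U (qs_mult V W))"
      by (simp add: qs_mult_prepend qs_mult_plus_right prepend_plus ac_simps)
    have "qs_mult (qs_mult ?x ?y) ?z = qs_mult ?x (qs_mult ?y ?z)"
      unfolding L R IH ..
    then show ?thesis by (simp add: U_V_W_def prepend_word del: qs_mult_word)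
  qed
qed

lemma qs_mult_assoc: "qs_mult (qs_mult p q) r = qs_mult p (qs_mult q r)"
proof (rule words_eqI)
  fix f
  have *: "ev f (qs_mult (qs_word u v) (word w)) = ev f (qs_mult (word u) (qs_word v w))" for u v w
    using qs_mult_assoc_word[of u v w] by simp
  have "ev f (qs_mult (qs_mult p q) r) =
      ev (\<lambda>u. ev (\<lambda>v. ev (\<lambda>w. ev f (qs_mult (qs_word u v) (word w))) r) q) p"
    by (simp add: ev_qs_mult ev_commute[of _ r])
  also have "\<dots> = ev f (qs_mult p (qs_mult q r))"
    unfolding * by (simp add: ev_qs_mult)
  finally show "ev f (qs_mult (qs_mult p q) r) = ev f (qs_mult p (qs_mult q r))" .
qed

lemma qs_ring_sel [simp]:
  "carrier qs_ring = UNIV" "x \<otimes>\<^bsub>qs_ring\<^esub> y = qs_mult x y" "\<one>\<^bsub>qs_ring\<^esub> = word []"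
  "\<zero>\<^bsub>qs_ring\<^esub> = 0" "x \<oplus>\<^bsub>qs_ring\<^esub> y = x + y"
  by (simp_all add: qs_ring_def)

lemma ring_qs_ring: "ring qs_ring"
proof (rule ringI)
  show "abelian_group qs_ring"
    by (rule abelian_groupI) (auto simp: ac_simps intro: exI[of _ "- _"] left_minus)
  show "monoid qs_ring"
    by (rule monoidI) (auto simp: qs_mult_assoc qs_mult_one_left qs_mult_one_right)
qed (auto simp: qs_mult_plus_left qs_mult_plus_right)

section \<open>Deconcatenation and convolution\<close>

definition splitsum :: "('x list \<Rightarrow> 'x list \<Rightarrow> 'b::comm_monoid_add) \<Rightarrow> 'x list \<Rightarrow> 'b" where
  "splitsum g w = (\<Sum>i\<le>length w. g (take i w) (drop i w))"

lemma splitsum_Nil [simp]: "splitsum g [] = g [] []"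
  by (simp add: splitsum_def)

lemma splitsum_Cons [simp]: "splitsum g (k # w) = g [] (k # w) + splitsum (\<lambda>x y. g (k # x) y) w"
  unfolding splitsum_def by (simp only: list.size sum.atMost_Suc_shift add_Suc_right add_0_right) simp

lemma splitsum_add: "splitsum (\<lambda>x y. g x y + h x y) w = splitsum g w + splitsum h w"
  by (simp add: splitsum_def sum.distrib)

definition conv :: "(int list \<Rightarrow> rat) \<Rightarrow> (int list \<Rightarrow> rat) \<Rightarrow> int list \<Rightarrow> rat" where
  "conv f g = splitsum (\<lambda>x y. f x * g y)"

text \<open>That deconcatenation is multiplicative, dualised to functionals.\<close>

lemma ev_conv_qs_word:
  "ev (conv f g) (qs_word u v) =
     splitsum (\<lambda>a b. splitsum (\<lambda>c d. ev f (qs_word a c) * ev g (qs_word b d)) v) u"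
proof (induction u v arbitrary: f rule: qs_word.induct)
  case (1 v)
  then show ?case by (simp add: conv_def)
next
  case (2 m u)
  then show ?case by (simp add: conv_def)
next
  case (3 m u n v)
  \<comment> \<open>A splitting of \<open>k # w\<close> has either an empty left part or one that
    starts with \<open>k\<close>; the latter replaces \<open>f\<close> by its shift by
    \<open>k\<close>, hence the induction with \<open>f\<close> arbitrary.\<close>
  have conv_Cons: "ev (\<lambda>w. conv f g (k # w)) p =
      f [] * ev (\<lambda>w. g (k # w)) p + ev (conv (\<lambda>w. f (k # w)) g) p" for k p
    by (simp add: conv_def ev_add_fun ev_mult_left)
  show ?case
    by (simp add: conv_Cons 3 splitsum_add algebra_simps)
qed


section \<open>Infinitesimal characters on words and their brackets\<close>

definition eps :: "int list \<Rightarrow> rat" where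
  "eps w = of_bool (w = [])"

lemma eps_simps [simp]: "eps [] = 1" "eps (k # w) = 0"
  by (simp_all add: eps_def)

lemma counit_eq_ev: "counit p = ev eps p"
  by (simp add: counit_def lookup_eq_ev eps_def[abs_def] of_bool_def)

lemma ev_eps_qs_word: "ev eps (qs_word u v) = eps u * eps v"
  by (induction u v rule: qs_word.induct) simp_all

lemma ev_eps_qs_mult: "ev eps (qs_mult p q) = ev eps p * ev eps q"
  by (simp add: ev_qs_mult ev_eps_qs_word ev_mult_left ev_mult_right)

definition infinitesimal :: "(int list \<Rightarrow> rat) \<Rightarrow> bool" where
  "infinitesimal d \<longleftrightarrow> (\<forall>u v. ev d (qs_word u v) = d u * eps v + eps u * d v)"

lemma infinitesimal_ev_qs_mult:
  assumes "infinitesimal d"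
  shows "ev d (qs_mult p q) = ev d p * ev eps q + ev eps p * ev d q"
  using assms
  by (simp add: infinitesimal_def ev_qs_mult ev_add_fun ev_mult_left ev_mult_right)

lemma splitsum_eps_left: "splitsum (\<lambda>x y. eps x * h x y) w = h [] w"
  by (cases w) (simp_all, simp add: splitsum_def)

lemma splitsum_eps_right: "splitsum (\<lambda>x y. eps y * h x y) w = h w []"
  by (induction w arbitrary: h) simp_all

lemma splitsum_mult_left: "splitsum (\<lambda>x y. c * h x y) w = c * (splitsum h w :: rat)"
  by (simp add: splitsum_def sum_distrib_left)

text \<open>The defect term \<open>f u * g v + f v * g u\<close> is symmetric in \<open>f\<close>
  and \<open>g\<close>, so it cancels in the commutator.\<close>

lemma ev_conv_qs_word_infinitesimal:
  assumes "infinitesimal f" "infinitesimal g"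
  shows "ev (conv f g) (qs_word u v) =
    conv f g u * eps v + eps u * conv f g v + (f u * g v + f v * g u)"
proof -
  have expand: "(f a * eps c + eps a * f c) * (g b * eps d + eps b * g d) =
      eps c * (eps d * (f a * g b)) + eps c * (eps b * (f a * g d))
      + eps d * (eps a * (f c * g b)) + eps a * (eps b * (f c * g d))" for a b c d
    by (simp add: algebra_simps)
  have "ev (conv f g) (qs_word u v) = splitsum (\<lambda>a b. splitsum (\<lambda>c d.
      (f a * eps c + eps a * f c) * (g b * eps d + eps b * g d)) v) u"
    using assms by (simp only: ev_conv_qs_word infinitesimal_def)
  also have "\<dots> = eps v * conv f g u + f u * g v + f v * g u + eps u * conv f g v"
    unfolding expand conv_def
    by (simp only: splitsum_add splitsum_eps_left splitsum_eps_right splitsum_mult_left)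
  finally show ?thesis by simp
qed

definition bracket :: "(int list \<Rightarrow> rat) \<Rightarrow> (int list \<Rightarrow> rat) \<Rightarrow> int list \<Rightarrow> rat" where
  "bracket f g w = conv f g w - conv g f w"

lemma infinitesimal_bracket:
  assumes "infinitesimal f" "infinitesimal g"
  shows "infinitesimal (bracket f g)"
  using assms unfolding infinitesimal_def[of "bracket f g"]
  by (simp add: bracket_def[abs_def] ev_diff_fun ev_conv_qs_word_infinitesimal algebra_simps)

section \<open>The binomial character and its linear coefficient\<close>

definition binomial_poly :: "nat \<Rightarrow> rat poly" where
  "binomial_poly n = smult (1 / fact n) (\<Prod>i<n. [:- of_nat i, 1:])"

lemma poly_binomial_poly: "poly (binomial_poly n) (of_nat t) = of_nat (t choose n)"
  by (simp add: binomial_poly_def poly_prod binomial_gbinomial gbinomial_prod_rev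
      atLeast0LessThan uminus_add_conv_diff)

lemma coeff_binomial_poly_0: "coeff (binomial_poly n) 0 = of_bool (n = 0)"
  using poly_binomial_poly[of n 0] by (cases n) (simp_all add: poly_0_coeff_0)

text \<open>This evaluates the quasi-symmetric function of a word at \<open>t\<close> variables equal to 1.\<close>

lemma ev_choose_qs_word:
  "ev (\<lambda>w. of_nat (t choose length w)) (qs_word u v) =
     of_nat (t choose length u) * of_nat (t choose length v)"
proof (induction u v arbitrary: t rule: qs_word.induct)
  case (3 m u n v)
  show ?case
  \<comment> \<open>Pascal's rule splits each binomial coefficient at \<open>Suc t\<close>. The part
    that keeps the lower index of the full word is covered by the inner hypothesis, the part that
    drops the first letter by the outer ones.\<close>
  proof (induction t)
    case (Suc t)
    then show ?case
      by (simp add: ev_add_fun 3 algebra_simps)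
  qed simp
qed simp_all

lemma poly_eqI_of_nat:
  fixes p q :: "'a::{idom,ring_char_0} poly"
  assumes "\<And>t. poly p (of_nat t) = poly q (of_nat t)"
  shows "p = q"
proof (rule ccontr)
  assume "p \<noteq> q"
  then have "finite {x. poly (p - q) x = 0}" by (intro poly_roots_finite) simp
  moreover have "range of_nat \<subseteq> {x. poly (p - q) x = 0}" using assms by auto
  ultimately have "finite (range (of_nat :: nat \<Rightarrow> 'a))" by (rule rev_finite_subset)
  then show False by (simp add: finite_image_iff inj_of_nat)
qed

text \<open>Multiplicativity at every natural \<open>t\<close> is an identity of polynomials in
  \<open>t\<close>, so it may be read off coefficient by coefficient.\<close>

lemma ev_coeff_binomial_poly:
  "ev (\<lambda>w. coeff (binomial_poly (length w)) i) (qs_word u v) =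
     coeff (binomial_poly (length u) * binomial_poly (length v)) i"
proof -
  define p where "p = qs_word u v"
  define Q where "Q = (\<Sum>w\<in>Poly_Mapping.keys p.
    smult (Poly_Mapping.lookup p w) (binomial_poly (length w)))"
  have "Q = binomial_poly (length u) * binomial_poly (length v)"
  proof (rule poly_eqI_of_nat)
    fix t
    have "poly Q (of_nat t) = ev (\<lambda>w. of_nat (t choose length w)) p"
      by (simp add: Q_def ev_def poly_sum poly_binomial_poly)
    then show "poly Q (of_nat t) = poly (binomial_poly (length u) * binomial_poly (length v)) (of_nat t)"
      by (simp add: p_def ev_choose_qs_word poly_binomial_poly)
  qed
  moreover have "coeff Q i = ev (\<lambda>w. coeff (binomial_poly (length w)) i) p"
    by (simp add: Q_def ev_def coeff_sum)
  ultimately show ?thesis by (simp add: p_def)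
qed

text \<open>The product is homogeneous for the weight. Since \<open>g\<close> sees weight and word
  separately, the induction can absorb a prepended letter into \<open>g\<close>.\<close>

lemma ev_sum_list_qs_word:
  "ev (\<lambda>w. g (sum_list w) w) (qs_word u v) = ev (g (sum_list u + sum_list v)) (qs_word u v)"
proof (induction u v arbitrary: g rule: qs_word.induct)
  case (3 m u n v)
  note IH = 3(1)[of "\<lambda>s w. g (m + s) (m # w)"] 3(2)[of "\<lambda>s w. g (n + s) (n # w)"]
    3(3)[of "\<lambda>s w. g (m + n + s) ((m + n) # w)"]
  show ?case using IH by (simp add: ac_simps)
qed simp_all

text \<open>The linear coefficient of the binomial polynomial is \<open>(-1)\<^sup>n\<^sup>-\<^sup>1 / n\<close>, so this is the
  \<open>z\<^sub>a\<close>-coefficient of Hoffman's logarithm.\<close>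

definition log_char :: "int \<Rightarrow> int list \<Rightarrow> rat" where
  "log_char a w = (if sum_list w = a then coeff (binomial_poly (length w)) 1 else 0)"

lemma infinitesimal_log_char: "infinitesimal (log_char a)"
  unfolding infinitesimal_def
proof (intro allI)
  fix u v :: "int list"
  let ?s = "sum_list u + sum_list v"
  have "ev (log_char a) (qs_word u v) =
      ev (\<lambda>w. if ?s = a then coeff (binomial_poly (length w)) 1 else 0) (qs_word u v)"
    unfolding log_char_def[abs_def]
    by (rule ev_sum_list_qs_word[of "\<lambda>s w. if s = a then coeff (binomial_poly (length w)) 1 else 0"])
  also have "\<dots> = (if ?s = a then coeff (binomial_poly (length u) * binomial_poly (length v)) 1 else 0)"
    by (simp add: ev_coeff_binomial_poly)
  \<comment> \<open>The linear coefficient of a product obeys the Leibniz rule, and the constant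
    coefficient of \<open>binomial_poly\<close> is the counit.\<close>
  also have "\<dots> = log_char a u * eps v + eps u * log_char a v"
    by (cases u; cases v) (auto simp: coeff_mult log_char_def coeff_binomial_poly_0)
  finally show "ev (log_char a) (qs_word u v) = log_char a u * eps v + eps u * log_char a v" .
qed

lemma log_char_Nil [simp]: "log_char a [] = 0"
  by (simp add: log_char_def binomial_poly_def)

lemma log_char_singleton [simp]: "log_char a [k] = of_bool (k = a)"
  by (simp add: log_char_def binomial_poly_def)

section \<open>Brackets of weight 0\<close>

definition balanced_char :: "int \<Rightarrow> int list \<Rightarrow> rat" where
  "balanced_char k = bracket (log_char k) (log_char (- k))"

lemma infinitesimal_balanced_char: "infinitesimal (balanced_char k)"
  by (simp add: balanced_char_def infinitesimal_bracket infinitesimal_log_char)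

lemma conv_log_char_eq_0:
  assumes "sum_list w \<noteq> a + b"
  shows "conv (log_char a) (log_char b) w = 0"
proof -
  have "sum_list (take i w) + sum_list (drop i w) = sum_list w" for i
    by (simp flip: sum_list_append)
  with assms show ?thesis
    unfolding conv_def splitsum_def log_char_def
    by (intro sum.neutral) (auto split: if_splits)
qed

lemma balanced_char_non_singular:
  assumes "non_singular w"
  shows "balanced_char k w = 0"
proof (cases "sum_list w = 0")
  case False
  then show ?thesis by (simp add: balanced_char_def bracket_def conv_log_char_eq_0)
next
  case True
  consider a where "w = [a]" | a b where "w = [a, b]" | "3 \<le> length w"
  proof (cases w rule: remdups_adj.cases)
    case (3 a b v)
    with that show ?thesis by (cases v) auto
  qed (use assms that in \<open>auto simp: non_singular_def\<close>)
  then show ?thesis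
  proof cases
    case 1
    then show ?thesis by (simp add: balanced_char_def bracket_def conv_def)
  next
    case 2
    with True have "w = [a, - a]" by simp
    then show ?thesis using assms by (simp add: non_singular_def)
  next
    case 3
    \<comment> \<open>The prefix condition at the full length alone excludes weight 0.\<close>
    then have "sum_list (take (length w) w) \<notin> {..int (length w)}"
      using assms unfolding non_singular_def by blast
    with True show ?thesis by simp
  qed
qed

text \<open>Only the splitting into \<open>[j]\<close> and \<open>[- j]\<close> has no empty part.
  It gives 1 in the first convolution exactly if \<open>j = k\<close>; the reversed one would need
  \<open>j = - k\<close>, against positivity.\<close>

lemma balanced_char_pair:
  assumes "0 < j" "0 < k"
  shows "balanced_char k [j, - j] = of_bool (j = k)"
  using assms by (simp add: balanced_char_def bracket_def conv_def)

section \<open>Passage to the quotient\<close>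

interpretation qs: ring qs_ring
  by (rule ring_qs_ring)

lemma ideal_N_ideal: "ideal N_ideal qs_ring"
  unfolding N_ideal_def by (rule qs.genideal_ideal) simp

lemma module_qscale: "Modules.module qscale"
  by unfold_locales (rule words_eqI, simp add: algebra_simps)+

text \<open>The kernel of \<open>d\<close> alone need not be an ideal, but by the Leibniz rule its
  intersection with the kernel of the counit is one.\<close>

lemma N_ideal_kernel:
  assumes d: "infinitesimal d" and ns: "\<And>w. non_singular w \<Longrightarrow> d w = 0"
  shows "N_ideal \<subseteq> {x. ev d x = 0 \<and> ev eps x = 0}" (is "_ \<subseteq> ?K")
proof -
  interpret Modules.module qscale by (rule module_qscale)
  have "ideal ?K qs_ring"
  proof (rule idealI[OF ring_qs_ring])
    show "subgroup ?K (add_monoid qs_ring)"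
    proof (rule qs.add.subgroupI)
      fix a assume "a \<in> ?K"
      then have "- a \<in> ?K" using ev_plus[of d a "- a"] ev_plus[of eps a "- a"] by simp
      moreover have "\<ominus>\<^bsub>qs_ring\<^esub> a = - a" by (rule qs.minus_equality) auto
      ultimately show "\<ominus>\<^bsub>qs_ring\<^esub> a \<in> ?K" by simp
    qed (auto intro: exI[of _ 0])
  qed (auto simp: infinitesimal_ev_qs_mult[OF d] ev_eps_qs_mult)
  moreover have "N_span \<subseteq> ?K"
    unfolding N_span_def
  proof (rule span_minimal)
    show "word ` Collect non_singular \<subseteq> ?K"
      using ns by (auto simp: eps_def) (simp add: non_singular_def)
    show "subspace ?K" by (auto simp: subspace_def)
  qed
  ultimately show ?thesis unfolding N_ideal_def by (rule qs.genideal_minimal)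
qed

abbreviation coset :: "words \<Rightarrow> words set" where
  "coset x \<equiv> N_ideal +>\<^bsub>qs_ring\<^esub> x"

lemma coset_eq: "coset x = (\<lambda>h. h + x) ` N_ideal"
  by (auto simp: a_r_coset_def' qs_ring_def)

lemma carrier_H_quot: "carrier H_quot = range coset"
  by (auto simp: H_quot_def FactRing_def A_RCOSETS_def')

lemma H_quot_add: "coset x \<oplus>\<^bsub>H_quot\<^esub> coset y = coset (x + y)"
  using ideal.a_rcos_sum[OF ideal_N_ideal, of x y] by (simp add: H_quot_def FactRing_def)

lemma H_quot_mult: "coset x \<otimes>\<^bsub>H_quot\<^esub> coset y = coset (qs_mult x y)"
  using ideal.rcoset_mult_add[OF ideal_N_ideal, of x y] by (simp add: H_quot_def FactRing_def)

lemma zero_in_N_ideal: "0 \<in> N_ideal"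
  using additive_subgroup.zero_closed[OF ideal.axioms(1)[OF ideal_N_ideal]] by simp

lemma coset_absorb: "h \<in> N_ideal \<Longrightarrow> coset (h + x) = coset x"
  using qs.a_repr_independence[of "h + x" N_ideal x] coset_eq[of x]
    additive_subgroup.a_subgroup[OF ideal.axioms(1)[OF ideal_N_ideal]] by simp

lemma quot_scale_coset: "quot_scale c (coset x) = coset (qscale c x)"
proof -
  \<comment> \<open>Scaling by \<open>c\<close> is multiplication by \<open>c\<close> times the
    unit, so a ring ideal is also a subspace.\<close>
  have "qscale c h \<in> N_ideal" if "h \<in> N_ideal" for h
    using ideal.I_l_closed[OF ideal_N_ideal that, of "qscale c (word [])"]
    by (simp add: qs_mult_qscale_left qs_mult_one_left)
  moreover have "qscale c (h + x) = qscale c h + qscale c x" for h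
    by (rule words_eqI) (simp add: algebra_simps)
  ultimately have "coset (qscale c (h + x)) = coset (qscale c x)" if "h \<in> N_ideal" for h
    using that by (simp add: coset_absorb)
  then show ?thesis
    unfolding quot_scale_def coset_eq[of x] using zero_in_N_ideal by auto
qed

lemma ev_image_coset:
  assumes "\<And>h. h \<in> N_ideal \<Longrightarrow> ev d h = 0"
  shows "the_elem (ev d ` coset x) = ev d x"
proof -
  have "ev d ` coset x = {ev d x}"
    unfolding coset_eq using assms zero_in_N_ideal by (force simp: image_iff)
  then show ?thesis by simp
qed

section \<open>Infinite dimension over a commutative ring\<close>

lemma sum_apply: "(\<Sum>v\<in>S. F v) y = (\<Sum>v\<in>S. F v y)" for F :: "'c \<Rightarrow> 'b \<Rightarrow> 'a::comm_monoid_add"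
  by (induction S rule: infinite_finite_induct) auto

text \<open>The points \<open>x j\<close> are dual to the functions \<open>f k\<close>. If
  \<open>n\<close> functions spanned, the identity matrix of size \<open>n + 1\<close> would factor
  through rank \<open>n\<close>; determinants refute this even in the presence of zero
  divisors.\<close>

lemma infinite_dim_mult:
  fixes f :: "nat \<Rightarrow> 'b \<Rightarrow> 'a::comm_ring_1"
  assumes V: "\<And>k. f k \<in> V" and f: "\<And>j k. f k (x j) = of_bool (j = k)"
  shows "infinite_dim (\<lambda>a g y. a * g y) V"
  unfolding infinite_dim_def
proof safe
  fix B assume B: "finite B" and sub: "V \<subseteq> module.span (\<lambda>a g y. a * g y) B"
  interpret Modules.module "\<lambda>(a::'a) (g :: 'b \<Rightarrow> 'a) y. a * g y"
    by unfold_locales (auto simp: fun_eq_iff algebra_simps)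
  have "\<forall>k. \<exists>u. f k = (\<Sum>v\<in>B. (\<lambda>y. u v * v y))"
    using V sub span_finite[OF B] by (metis (no_types, lifting) rangeE subsetD)
  then obtain u where u: "f k = (\<Sum>v\<in>B. (\<lambda>y. u k v * v y))" for k by metis
  obtain b n where b: "bij_betw b {0..<n::nat} B"
    using ex_bij_betw_nat_finite[OF B] by blast
  \<comment> \<open>A zero column in \<open>P\<close> and a zero row in \<open>Q\<close> pad the
    factors to square matrices, which have determinants.\<close>
  define P where "P = mat (Suc n) (Suc n) (\<lambda>(j, i). if i < n then b i (x j) else 0)"
  define Q where "Q = mat (Suc n) (Suc n) (\<lambda>(i, k). if i < n then u k (b i) else 0)"
  have [simp]: "P \<in> carrier_mat (Suc n) (Suc n)" "Q \<in> carrier_mat (Suc n) (Suc n)"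
    by (simp_all add: P_def Q_def)
  have "P * Q = 1\<^sub>m (Suc n)"
  proof (rule eq_matI)
    fix j k assume "j < dim_row (1\<^sub>m (Suc n) :: 'a mat)" "k < dim_col (1\<^sub>m (Suc n) :: 'a mat)"
    then have jk: "j < Suc n" "k < Suc n" by simp_all
    have "(P * Q) $$ (j, k) = (\<Sum>i = 0..<n. u k (b i) * b i (x j))"
      using jk by (simp add: P_def Q_def scalar_prod_def mult.commute)
    also have "\<dots> = (\<Sum>v\<in>B. u k v * v (x j))"
      using sum.reindex_bij_betw[OF b, of "\<lambda>v. u k v * v (x j)"] by simp
    also have "\<dots> = of_bool (j = k)"
      using f[of k j] by (simp add: u sum_apply)
    finally show "(P * Q) $$ (j, k) = 1\<^sub>m (Suc n) $$ (j, k)" using jk by simp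
  qed (simp_all add: P_def Q_def)
  then have "det P * det Q = 1"
    using det_mult[of P "Suc n" Q] by simp
  moreover have "det Q = 0"
  proof -
    \<comment> \<open>The factor at \<open>i = n\<close> lies in the zero row, and
      \<open>p n\<close> is still a valid column.\<close>
    have "(\<Prod>i = 0..<Suc n. Q $$ (i, p i)) = 0" if "p permutes {0..<Suc n}" for p
      using permutes_in_image[OF that, of n] by (simp add: Q_def)
    then show ?thesis by (simp add: det_def'[of Q "Suc n"])
  qed
  ultimately show False by simp
qed

section \<open>Characters with values in the algebra\<close>

context comm_rat_algebra
begin

definition lift_char :: "(int list \<Rightarrow> rat) \<Rightarrow> words set \<Rightarrow> 'a" where
  "lift_char d X = (if X \<in> carrier H_quot then scale (the_elem (ev d ` X)) 1 else 0)"

lemma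
  assumes d: "infinitesimal d" and ns: "\<And>w. non_singular w \<Longrightarrow> d w = 0"
  shows lift_char_coset: "lift_char d (coset x) = scale (ev d x) 1"
    and lift_char_in_inf_chars: "lift_char d \<in> inf_chars scale"
proof -
  show lift: "lift_char d (coset x) = scale (ev d x) 1" for x
    using N_ideal_kernel[OF d ns] unfolding lift_char_def
    by (subst ev_image_coset) (auto simp: carrier_H_quot)
  have counit: "quot_counit (coset x) = ev eps x" for x
    using N_ideal_kernel[OF d ns] unfolding quot_counit_def
    by (subst ev_image_coset[symmetric]) (auto simp: counit_eq_ev[abs_def])
  show "lift_char d \<in> inf_chars scale"
    unfolding inf_chars_def
    by (auto simp: carrier_H_quot H_quot_add H_quot_mult quot_scale_coset lift counit
        infinitesimal_ev_qs_mult[OF d] scale_left_distrib mult.commute)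
      (auto simp: lift_char_def carrier_H_quot)
qed

text \<open>Scaling by \<open>c\<close> is multiplication by \<open>scale c 1\<close>, so a rational
  span lies in the span over the algebra, and a finite rational spanning set would also span
  there.\<close>

lemma infinite_dim_scale:
  assumes "infinite_dim (\<lambda>a g y. a * g y) (V :: ('b \<Rightarrow> 'a) set)"
  shows "infinite_dim (\<lambda>c g y. scale c (g y)) V"
proof -
  interpret A: Modules.module "\<lambda>(a::'a) (g :: 'b \<Rightarrow> 'a) y. a * g y"
    by unfold_locales (auto simp: fun_eq_iff algebra_simps)
  interpret Q: Modules.module "\<lambda>c (g :: 'b \<Rightarrow> 'a) y. scale c (g y)"
    by unfold_locales (auto simp: fun_eq_iff scale_right_distrib scale_left_distrib)
  have "Q.span B \<subseteq> A.span B" for B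
  proof (rule Q.span_minimal)
    show "Q.subspace (A.span B)"
      unfolding Q.subspace_def
    proof safe
      fix c and g :: "'b \<Rightarrow> 'a" assume "g \<in> A.span B"
      then have "(\<lambda>y. scale c 1 * g y) \<in> A.span B" by (rule A.span_scale)
      then show "(\<lambda>y. scale c (g y)) \<in> A.span B" by (simp flip: scale_mult)
    qed (auto intro: A.span_zero A.span_add)
  qed (rule A.span_superset)
  with assms show ?thesis unfolding infinite_dim_def by (meson order_trans)
qed

end

theorem theorem5p3:
  fixes scale :: "rat \<Rightarrow> 'a::comm_ring_1 \<Rightarrow> 'a"
  assumes "comm_rat_algebra scale"
  shows "infinite_dim (\<lambda>c \<delta> X. scale c (\<delta> X)) (inf_chars scale)
    \<and> infinite_dim (\<lambda>a \<delta> X. a * \<delta> X) (inf_chars scale)"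
proof -
  interpret comm_rat_algebra scale by fact
  \<comment> \<open>The shift by one keeps all indices positive, as
    \<open>balanced_char_pair\<close> requires.\<close>
  let ?i = "\<lambda>n. int (Suc n)"
  let ?f = "\<lambda>n. lift_char (balanced_char (?i n))"
  have "infinite_dim (\<lambda>a \<delta> X. a * \<delta> X) (inf_chars scale)"
  proof (rule infinite_dim_mult)
    show "?f k \<in> inf_chars scale" for k
      by (intro lift_char_in_inf_chars infinitesimal_balanced_char balanced_char_non_singular)
    show "?f k (coset (word [?i j, - ?i j])) = of_bool (j = k)" for j k
      by (subst lift_char_coset[OF infinitesimal_balanced_char balanced_char_non_singular])
        (simp_all only: ev_word balanced_char_pair of_nat_0_less_iff zero_less_Suc, simp)
  qed
  then show ?thesis using infinite_dim_scale by blast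
qed

end
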